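(* Let $n\ge2$ and let $\mathcal C=X_1\cap\dots\cap X_n$ be a tropical complete intersection curve in $\mathbb R^{n+1}$, where $X_i$ is smooth of degree $d_i$ for $i=1,\dots,n$. Then $$\sum_{P\in\mathcal C^{(0)}}m_P=d_1d_2\cdots d_n\,(d_1+d_2+\dots+d_n),$$ where $\mathcal C^{(0)}$ is the set of vertices of $\mathcal C$ and $m_P$ is the intersection multiplicity at $P$.
   Context: Over $(\mathbb R,\max,+)$, a tropical polynomial is $f(x)=\max_{a\in\mathcal A}\{\lambda_a+a\cdot x\}$, $\mathcal A\subseteq\mathbb Z^{m}$ finite, $\lambda_a\in\mathbb R$; Newton polytope $\Delta_f=\operatorname{conv}(\mathcal A)$; lifted polytope $\tilde\Delta_f=\operatorname{conv}\{(a,t):a\in\mathcal A,t\le\lambda_a\}$, whose bounded faces project to a regular lattice subdivision $\operatorname{Subdiv}(f)$ of $\Delta_f$. $V_{tr}(f)$ is the non-linear locus of $f$, a polyhedral complex of pure dimension $m-1$, with a bijection $C\mapsto C^\vee$ from $k$-cells of $V_{tr}(f)$ to $(m-k)$-cells of $\operatorname{Subdiv}(f)$, $C^\vee=\operatorname{conv}\{a:\lambda_a+a\cdot x=f(x)\}$ for $x$ in the relative interior of $C$. $V_{tr}(f)$ is smooth of degree $d$ if every maximal cell of $\operatorname{Subdiv}(f)$ is a lattice simplex of volume $1/m!$ and $\Delta_f=\Gamma^m_d:=\operatorname{conv}\{0,de_1,\dots,de_m\}$. For $X_i=V_{tr}(f_i)$, $i=1,\dots,n$, let $U=X_1\cup\dots\cup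 X_n=V_{tr}(f_1\odot\cdots\odot f_n)$ (the product polynomial has function $f_1+\dots+f_n$), and $\operatorname{Subdiv}_U=\operatorname{Subdiv}(f_1\odot\cdots\odot f_n)$. Since $\tilde\Delta_{f_1\odot\cdots\odot f_n}=\tilde\Delta_{f_1}+\dots+\tilde\Delta_{f_n}$, each bounded face decomposes uniquely as a Minkowski sum of bounded faces of the $\tilde\Delta_{f_i}$; projecting gives the privileged representation $\Lambda=\Lambda_1+\dots+\Lambda_n$ of each cell of $\operatorname{Subdiv}_U$. Each cell $C$ of $X_1\cap\dots\cap X_n$ is uniquely $C_1\cap\dots\cap C_n$ with $C_i$ a cell of $X_i$ containing $C$ in its relative interior; $C$ is a cell of $U$ and $C^\vee\in\operatorname{Subdiv}_U$ has privileged representation $C_1^\vee+\dots+C_n^\vee$. The intersection is transversal if for all $J\subseteq\{1,\dots,n\}$, $|J|\ge2$, $\bigcap_{i\in J}X_i$ has dimension $m-|J|$ and every cell $C$ of it satisfies $\dim C^\vee=\sum_{i\in J}\dim C_i^\vee$ (duals w.r.t. $\bigcup_{i\in J}X_i$). A tropical complete intersection curve is a transversal intersection $\mathcal C=X_1\cap\dots\cap X_n$ of $n\ge2$ smooth tropical hypersurfaces in $\mathbb R^{n+1}$ (so $m=n+1$); it is a one-dimensional polyhedral complex with some unbounded edges. The intersection multiplicity at a vertex $P$ of $\mathcal C$ is $m_P=2\operatorname{vol}_{n+1}(P^\vee)$, with $P^\vee\in\operatorname{Subdiv}_U$. *)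

theory Defs
  imports "HOL-Analysis.Analysis"
begin

text \<open>A tropical polynomial in m variables (m = CARD('m)) is given by a finite nonempty
  support A of integer exponent vectors and coefficients lam a for a in A.\<close>

definition rvec :: "int^'m \<Rightarrow> real^'m" where
  "rvec a = (\<chi> k. real_of_int (a $ k))"

definition tpoly :: "(int^'m) set \<Rightarrow> bool" where
  "tpoly A \<longleftrightarrow> finite A \<and> A \<noteq> {}"

definition teval :: "(int^'m) set \<Rightarrow> (int^'m \<Rightarrow> real) \<Rightarrow> real^'m \<Rightarrow> real" where
  "teval A lam x = Max ((\<lambda>a. lam a + rvec a \<bullet> x) ` A)"

definition argmax_set :: "(int^'m) set \<Rightarrow> (int^'m \<Rightarrow> real) \<Rightarrow> real^'m \<Rightarrow> (int^'m) set" where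
  "argmax_set A lam x = {a \<in> A. lam a + rvec a \<bullet> x = teval A lam x}"

text \<open>The cell of Subdiv(f) dual to the cell of V(f) (or of a complementary region)
  containing x in its relative interior: conv of the exponents attaining the maximum.\<close>
definition dual_cell :: "(int^'m) set \<Rightarrow> (int^'m \<Rightarrow> real) \<Rightarrow> real^'m \<Rightarrow> (real^'m) set" where
  "dual_cell A lam x = convex hull (rvec ` argmax_set A lam x)"

definition trop_hyp :: "(int^'m) set \<Rightarrow> (int^'m \<Rightarrow> real) \<Rightarrow> (real^'m) set" where
  "trop_hyp A lam = {x. \<not> (\<exists>e>0. \<exists>v c. \<forall>y\<in>ball x e. teval A lam y = v \<bullet> y + c)}"

definition newton_polytope :: "(int^'m) set \<Rightarrow> (real^'m) set" where
  "newton_polytope A = convex hull (rvec ` A)"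

definition std_simplex :: "nat \<Rightarrow> (real^'m) set" where
  "std_simplex d = convex hull (insert 0 ((\<lambda>k. real d *\<^sub>R axis k 1) ` UNIV))"

definition lattice_simplex :: "(real^'m) set \<Rightarrow> bool" where
  "lattice_simplex S \<longleftrightarrow> (\<exists>V. V \<subseteq> range rvec \<and> card V = CARD('m) + 1 \<and>
       \<not> affine_dependent V \<and> S = convex hull V)"

text \<open>The cells of Subdiv(f) are exactly the sets dual_cell A lam x (x ranging over R^m);
  the maximal ones are the full-dimensional ones.\<close>
definition smooth_hyp :: "(int^'m) set \<Rightarrow> (int^'m \<Rightarrow> real) \<Rightarrow> nat \<Rightarrow> bool" where
  "smooth_hyp A lam d \<longleftrightarrow>
     newton_polytope A = std_simplex d \<and>
     (\<forall>x. aff_dim (dual_cell A lam x) = int CARD('m) \<longrightarrow>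
          lattice_simplex (dual_cell A lam x) \<and>
          measure lebesgue (dual_cell A lam x) = 1 / fact CARD('m))"

definition prodA :: "nat set \<Rightarrow> (nat \<Rightarrow> (int^'m) set) \<Rightarrow> (int^'m) set" where
  "prodA J A = {(\<Sum>i\<in>J. a i) | a. \<forall>i\<in>J. a i \<in> A i}"

definition prodlam :: "nat set \<Rightarrow> (nat \<Rightarrow> (int^'m) set) \<Rightarrow> (nat \<Rightarrow> int^'m \<Rightarrow> real)
                        \<Rightarrow> int^'m \<Rightarrow> real" where
  "prodlam J A lam b = Max {(\<Sum>i\<in>J. lam i (a i)) | a. (\<forall>i\<in>J. a i \<in> A i) \<and> (\<Sum>i\<in>J. a i) = b}"

text \<open>Intersection of the X_i, i in J, and the relative interior of its cell containing x
  (the intersection of the relative interiors of the cells C_i of X_i containing x).\<close>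
definition inter_J :: "nat set \<Rightarrow> (nat \<Rightarrow> (int^'m) set) \<Rightarrow> (nat \<Rightarrow> int^'m \<Rightarrow> real)
                        \<Rightarrow> (real^'m) set" where
  "inter_J J A lam = (\<Inter>i\<in>J. trop_hyp (A i) (lam i))"

definition cell_J :: "nat set \<Rightarrow> (nat \<Rightarrow> (int^'m) set) \<Rightarrow> (nat \<Rightarrow> int^'m \<Rightarrow> real)
                        \<Rightarrow> real^'m \<Rightarrow> (real^'m) set" where
  "cell_J J A lam x = {y. \<forall>i\<in>J. dual_cell (A i) (lam i) y = dual_cell (A i) (lam i) x}"

definition transversal :: "nat set \<Rightarrow> (nat \<Rightarrow> (int^'m) set) \<Rightarrow> (nat \<Rightarrow> int^'m \<Rightarrow> real) \<Rightarrow> bool" where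
  "transversal I A lam \<longleftrightarrow>
     (\<forall>J. J \<subseteq> I \<and> card J \<ge> 2 \<longrightarrow>
        (\<exists>x\<in>inter_J J A lam. aff_dim (cell_J J A lam x) = int CARD('m) - int (card J)) \<and>
        (\<forall>x\<in>inter_J J A lam.
            aff_dim (cell_J J A lam x) \<le> int CARD('m) - int (card J) \<and>
            aff_dim (dual_cell (prodA J A) (prodlam J A lam) x) =
              (\<Sum>i\<in>J. aff_dim (dual_cell (A i) (lam i) x))))"

definition curve_vertices :: "nat set \<Rightarrow> (nat \<Rightarrow> (int^'m) set) \<Rightarrow> (nat \<Rightarrow> int^'m \<Rightarrow> real)
                        \<Rightarrow> (real^'m) set" where
  "curve_vertices I A lam = {x \<in> inter_J I A lam. cell_J I A lam x = {x}}"

text \<open>m_P = 2 vol(P^dual), P^dual taken in Subdiv_U (U the union of all X_i).\<close>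
definition int_mult :: "nat set \<Rightarrow> (nat \<Rightarrow> (int^'m) set) \<Rightarrow> (nat \<Rightarrow> int^'m \<Rightarrow> real)
                        \<Rightarrow> real^'m \<Rightarrow> real" where
  "int_mult I A lam P = 2 * measure lebesgue (dual_cell (prodA I A) (prodlam I A lam) P)"

end

theory Submission
  imports Defs
begin

text \<open>
  Cells of a regular subdivision are the subdifferentials of the tropical polynomial function, so the
  full-dimensional ones tile the Newton polytope up to null sets. For \<open>J \<subseteq> {1..n}\<close> group the tiles of
  the product of the \<open>f\<^sub>i\<close>, \<open>i \<in> J\<close>, by the set \<open>K \<subseteq> J\<close> of hypersurfaces through the dual vertex: the
  tile is a translate of the one of \<open>\<Prod>\<^sub>K f\<^sub>i\<close>, and by transversality a vertex whose
  \<open>K\<close>-tile is already full-dimensional lies on no further hypersurface. With \<open>w(K)\<close> the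
  total volume of the tiles of type \<open>K\<close> and \<open>m = n + 1\<close> this reads
  \<open>(\<Sum>i\<in>J. d\<^sub>i)^m / m! = (\<Sum>K\<subseteq>J. w(K))\<close>. Moebius inversion expresses \<open>w({1..n})\<close>, which is
  half the sum of the intersection multiplicities, as an alternating sum of \<open>m\<close>-th powers that
  evaluates to \<open>(\<Prod>d\<^sub>i) (\<Sum>d\<^sub>i) / 2\<close>.
\<close>

subsection \<open>Alternating sums over subsets\<close>

lemma sum_Pow_insert:
  fixes f :: "'a set \<Rightarrow> 'b::comm_monoid_add"
  assumes "finite I" "i \<notin> I"
  shows "sum f (Pow (insert i I)) = (\<Sum>J\<in>Pow I. f J) + (\<Sum>J\<in>Pow I. f (insert i J))"
proof -
  have "inj_on (insert i) (Pow I)"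
    using assms(2) by (auto simp: inj_on_def)
  moreover have "Pow I \<inter> insert i ` Pow I = {}"
    using assms(2) by auto
  ultimately show ?thesis
    using assms(1) by (simp add: Pow_insert sum.union_disjoint sum.reindex)
qed

text \<open>Pairing \<open>J\<close> with \<open>insert i J\<close>, which carry opposite signs,
  turns the alternating sum into one of first differences in direction \<open>i\<close>. This drives
  the inductions on the index set below.\<close>

lemma alternating_sum_insert:
  fixes F :: "'a set \<Rightarrow> 'b::comm_ring_1"
  assumes "finite I" "i \<notin> I"
  shows "(\<Sum>J\<in>Pow (insert i I). (-1) ^ card (insert i I - J) * F J) =
         (\<Sum>J\<in>Pow I. (-1) ^ card (I - J) * (F (insert i J) - F J))"
proof -
  have "(-1) ^ card (insert i I - J) * F J = - ((-1) ^ card (I - J) * F J)"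
    if "J \<in> Pow I" for J
  proof -
    have "insert i I - J = insert i (I - J)" using that assms by auto
    then show ?thesis using assms by simp
  qed
  moreover have "(-1) ^ card (insert i I - insert i J) * F (insert i J) =
      (-1) ^ card (I - J) * F (insert i J)" if "J \<in> Pow I" for J
  proof -
    have "insert i I - insert i J = I - J" using that assms by auto
    then show ?thesis by simp
  qed
  ultimately show ?thesis
    by (simp add: sum_Pow_insert[OF assms] sum.distrib[symmetric] algebra_simps)
qed

text \<open>Taking the difference in direction \<open>i\<close> turns the subset sum of
  \<open>w\<close> into the subset sum of the shifted function \<open>w (insert i K)\<close>; the
  induction therefore has to keep \<open>w\<close> arbitrary.\<close>

lemma subset_moebius_inversion:
  fixes w :: "'a set \<Rightarrow> 'b::comm_ring_1"
  assumes "finite I"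
  shows "(\<Sum>J\<in>Pow I. (-1) ^ card (I - J) * (\<Sum>K\<in>Pow J. w K)) = w I"
  using assms
proof (induction I arbitrary: w)
  case empty
  then show ?case by simp
next
  case (insert i I)
  have "(\<Sum>K\<in>Pow (insert i J). w K) - (\<Sum>K\<in>Pow J. w K) = (\<Sum>K\<in>Pow J. w (insert i K))"
    if "J \<in> Pow I" for J
    using that insert.hyps by (subst sum_Pow_insert) (auto intro: finite_subset)
  then have "(\<Sum>J\<in>Pow (insert i I). (-1) ^ card (insert i I - J) * (\<Sum>K\<in>Pow J. w K)) =
     (\<Sum>J\<in>Pow I. (-1) ^ card (I - J) * (\<Sum>K\<in>Pow J. w (insert i K)))"
    by (subst alternating_sum_insert[OF insert.hyps]) (intro sum.cong, auto)
  also have "\<dots> = w (insert i I)"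
    by (rule insert.IH)
  finally show ?case .
qed

text \<open>The iterated finite difference at 0 of the \<open>p\<close>-th power with steps
  \<open>d i\<close>; equivalently \<open>p!\<close> times the coefficient of \<open>t^p\<close> in
  the product of the series \<open>exp (d i * t) - 1\<close> over \<open>i\<close> in
  \<open>I\<close>.\<close>

definition alt_power_sum :: "('a \<Rightarrow> real) \<Rightarrow> 'a set \<Rightarrow> nat \<Rightarrow> real" where
  "alt_power_sum d I p = (\<Sum>J\<in>Pow I. (-1) ^ card (I - J) * (sum d J) ^ p)"

text \<open>Binomial expansion of the first difference in direction \<open>i\<close>. The term
  \<open>k = p\<close> is cancelled by the subtracted power, hence the strict bound on
  \<open>k\<close>.\<close>

lemma alt_power_sum_insert:
  assumes "finite I" "i \<notin> I"
  shows "alt_power_sum d (insert i I) p =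
         (\<Sum>k<p. of_nat (p choose k) * d i ^ (p - k) * alt_power_sum d I k)"
proof -
  have "sum d (insert i J) ^ p - sum d J ^ p =
      (\<Sum>k<p. of_nat (p choose k) * d i ^ (p - k) * sum d J ^ k)" if "J \<in> Pow I" for J
  proof -
    have "sum d (insert i J) = sum d J + d i"
      using that assms by (subst sum.insert) (auto intro: finite_subset)
    then have "sum d (insert i J) ^ p = (\<Sum>k\<le>p. of_nat (p choose k) * sum d J ^ k * d i ^ (p - k))"
      by (simp add: binomial_ring)
    also have "{..p} = insert p {..<p}" by auto
    finally show ?thesis by (simp add: mult_ac)
  qed
  then have "alt_power_sum d (insert i I) p =
      (\<Sum>J\<in>Pow I. (-1) ^ card (I - J) * (\<Sum>k<p. of_nat (p choose k) * d i ^ (p - k) * sum d J ^ k))"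
    unfolding alt_power_sum_def alternating_sum_insert[OF assms] by (intro sum.cong) auto
  also have "\<dots> = (\<Sum>k<p. of_nat (p choose k) * d i ^ (p - k) * alt_power_sum d I k)"
    unfolding alt_power_sum_def sum_distrib_left
    by (subst sum.swap) (simp add: mult_ac)
  finally show ?thesis .
qed

text \<open>The two lowest coefficients of the product of the series
  \<open>exp (d i * t) - 1\<close>: each factor starts with
  \<open>d i * t * (1 + d i * t / 2)\<close>, so nothing occurs below degree \<open>card I\<close>.
  In the recursion this vanishing leaves only one or two terms.\<close>

lemma alt_power_sum_values:
  assumes "finite I"
  shows "(\<forall>p<card I. alt_power_sum d I p = 0) \<and>
         alt_power_sum d I (card I) = fact (card I) * prod d I \<and>
         alt_power_sum d I (Suc (card I)) = fact (Suc (card I)) / 2 * prod d I * sum d I"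
  using assms
proof (induction I)
  case empty
  then show ?case by (simp add: alt_power_sum_def)
next
  case (insert i I)
  define n where "n = card I"
  have IH: "\<And>p. p < n \<Longrightarrow> alt_power_sum d I p = 0"
    "alt_power_sum d I n = fact n * prod d I"
    "alt_power_sum d I (Suc n) = fact (Suc n) / 2 * prod d I * sum d I"
    using insert.IH by (auto simp: n_def)
  note ins = alt_power_sum_insert[OF insert.hyps]
  have "alt_power_sum d (insert i I) p = 0" if "p < Suc n" for p
    unfolding ins using that IH(1) by (intro sum.neutral) auto
  moreover have "alt_power_sum d (insert i I) (Suc n) = fact (Suc n) * (d i * prod d I)"
    unfolding ins using IH(1,2) by (simp add: algebra_simps)
  moreover have "alt_power_sum d (insert i I) (Suc (Suc n)) =
      fact (Suc (Suc n)) / 2 * (d i * prod d I) * (d i + sum d I)"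
  proof -
    have c: "real (Suc (Suc n) choose n) = real (Suc (Suc n)) * real (Suc n) / 2"
    proof -
      have "real (Suc (Suc n) choose n) = fact (Suc (Suc n)) / (fact n * fact (Suc (Suc n) - n))"
        by (rule binomial_fact) simp
      also have "Suc (Suc n) - n = 2" by simp
      finally show ?thesis by (simp del: of_nat_Suc)
    qed
    \<comment> \<open>Only \<open>k = n\<close> and \<open>k = Suc n\<close> survive in the
      recursion.\<close>
    have "alt_power_sum d (insert i I) (Suc (Suc n)) =
       of_nat (Suc (Suc n) choose n) * (d i)\<^sup>2 * (fact n * prod d I) +
       of_nat (Suc (Suc n)) * d i * (fact (Suc n) / 2 * prod d I * sum d I)"
      unfolding ins using IH by (simp add: power2_eq_square)
    then show ?thesis
      unfolding c by (simp add: field_simps power2_eq_square)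
  qed
  ultimately show ?case
    using insert.hyps by (simp add: n_def)
qed

subsection \<open>Dual cells as subdifferentials\<close>

lemma teval_ge:
  assumes "finite A" "a \<in> A"
  shows "lam a + rvec a \<bullet> x \<le> teval A lam x"
  using assms by (auto simp: teval_def)

lemma argmax_set_nonempty:
  assumes "tpoly A"
  shows "argmax_set A lam x \<noteq> {}"
proof -
  have "teval A lam x \<in> (\<lambda>a. lam a + rvec a \<bullet> x) ` A"
    using assms unfolding teval_def tpoly_def by (intro Max_in) auto
  then show ?thesis by (auto simp: argmax_set_def)
qed

lemma finite_argmax_set: "tpoly A \<Longrightarrow> finite (argmax_set A lam x)"
  by (simp add: argmax_set_def tpoly_def)

lemma compact_dual_cell: "tpoly A \<Longrightarrow> compact (dual_cell A lam x)"
  unfolding dual_cell_def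
  by (intro compact_convex_hull finite_imp_compact finite_imageI finite_argmax_set)

lemma convex_dual_cell: "convex (dual_cell A lam x)"
  by (simp add: dual_cell_def)

lemma dual_cell_nonempty: "tpoly A \<Longrightarrow> dual_cell A lam x \<noteq> {}"
  by (simp add: dual_cell_def argmax_set_nonempty)

lemma rvec_mem_dual_cell: "a \<in> argmax_set A lam x \<Longrightarrow> rvec a \<in> dual_cell A lam x"
  by (simp add: dual_cell_def hull_inc)

lemma rvec_inject [simp]: "rvec a = rvec b \<longleftrightarrow> a = b"
  by (simp add: rvec_def vec_eq_iff)

lemma dual_cell_singleton: "argmax_set A lam x = {a} \<Longrightarrow> dual_cell A lam x = {rvec a}"
  by (simp add: dual_cell_def)

lemma dual_cell_subset_newton_polytope: "dual_cell A lam x \<subseteq> newton_polytope A"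
  unfolding dual_cell_def newton_polytope_def argmax_set_def by (intro hull_mono) auto

text \<open>An exponent that loses strictly against a maximiser \<open>b\<close> at \<open>x\<close>
  still loses against \<open>b\<close> nearby, and there are only finitely many exponents.\<close>

lemma eventually_argmax_set_subset:
  assumes "tpoly A"
  shows "\<forall>\<^sub>F y in nhds x. argmax_set A lam y \<subseteq> argmax_set A lam x"
proof -
  have fin: "finite A" using assms by (simp add: tpoly_def)
  obtain b where b: "b \<in> argmax_set A lam x" using argmax_set_nonempty[OF assms] by blast
  have "\<forall>\<^sub>F y in nhds x. a \<in> argmax_set A lam y \<longrightarrow> a \<in> argmax_set A lam x" if "a \<in> A" for a
  proof (cases "a \<in> argmax_set A lam x")
    case False
    let ?S = "{y. lam a + rvec a \<bullet> y < lam b + rvec b \<bullet> y}"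
    have "open ?S" by (intro open_Collect_less continuous_intros)
    moreover have "x \<in> ?S"
      using False b that teval_ge[OF fin that, of lam x] by (auto simp: argmax_set_def)
    ultimately have "\<forall>\<^sub>F y in nhds x. y \<in> ?S" by (rule eventually_nhds_in_open)
    then show ?thesis
    proof eventually_elim
      case (elim y)
      then show ?case
        using b teval_ge[OF fin, of b lam y] by (auto simp: argmax_set_def)
    qed
  qed simp
  then have "\<forall>\<^sub>F y in nhds x. \<forall>a\<in>A. a \<in> argmax_set A lam y \<longrightarrow> a \<in> argmax_set A lam x"
    using fin by (intro eventually_ball_finite) auto
  then show ?thesis
    by eventually_elim (auto simp: argmax_set_def)
qed

lemma eventually_argmax_set_subset_ray:
  assumes "tpoly A"
  shows "\<forall>\<^sub>F t in at_right 0. argmax_set A lam (x + t *\<^sub>R v) \<subseteq> argmax_set A lam x"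
proof -
  have "((\<lambda>t. x + t *\<^sub>R v) \<longlongrightarrow> x + 0 *\<^sub>R v) (at_right 0)"
    by (intro tendsto_intros)
  then have "filterlim (\<lambda>t. x + t *\<^sub>R v) (nhds x) (at_right 0)" by simp
  then show ?thesis
    by (rule filterlim_iff[THEN iffD1, rule_format]) (rule eventually_argmax_set_subset[OF assms])
qed

text \<open>For a maximising exponent this is \<open>teval_ge\<close>; the inequality is linear in
  \<open>p\<close>, so it passes to the convex hull. With the converse below, the dual cell is the
  subdifferential of the convex function \<open>teval A lam\<close> at \<open>x\<close>.\<close>

lemma dual_cell_imp_subgradient:
  assumes "tpoly A" "p \<in> dual_cell A lam x"
  shows "teval A lam x + p \<bullet> (y - x) \<le> teval A lam y"
proof -
  have "dual_cell A lam x \<subseteq> {q. (y - x) \<bullet> q \<le> teval A lam y - teval A lam x}"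
    unfolding dual_cell_def
  proof (intro hull_minimal convex_halfspace_le, clarify)
    fix a assume "a \<in> argmax_set A lam x"
    then show "(y - x) \<bullet> rvec a \<le> teval A lam y - teval A lam x"
      using teval_ge[of A a lam y] assms(1)
      by (auto simp: argmax_set_def tpoly_def inner_diff_right inner_commute[of _ "rvec a"])
  qed
  then show ?thesis using assms(2) by (auto simp: inner_commute)
qed

text \<open>A point \<open>p\<close> outside the cell is separated from it by a hyperplane with
  normal \<open>u\<close>. On a small move from \<open>x\<close> along \<open>-u\<close> the maximum
  is still attained by exponents of the cell, so it falls faster than the slope \<open>p\<close>
  permits.\<close>

lemma subgradient_imp_dual_cell:
  assumes "tpoly A" and sub: "\<And>y. teval A lam x + p \<bullet> (y - x) \<le> teval A lam y"
  shows "p \<in> dual_cell A lam x"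
proof (rule ccontr)
  assume "p \<notin> dual_cell A lam x"
  then obtain u b where u: "u \<bullet> p < b" "\<And>q. q \<in> dual_cell A lam x \<Longrightarrow> u \<bullet> q > b"
    using separating_hyperplane_closed_point[OF convex_dual_cell
        compact_imp_closed[OF compact_dual_cell[OF assms(1)]]] by blast
  have "\<forall>\<^sub>F t::real in at_right 0. 0 < t \<and> argmax_set A lam (x + t *\<^sub>R (-u)) \<subseteq> argmax_set A lam x"
    by (intro eventually_conj eventually_at_right_less eventually_argmax_set_subset_ray assms(1))
  then obtain t :: real where t: "0 < t" "argmax_set A lam (x + t *\<^sub>R (-u)) \<subseteq> argmax_set A lam x"
    using eventually_happens'[OF trivial_limit_at_right_real] by blast
  obtain a where a: "a \<in> argmax_set A lam (x + t *\<^sub>R (-u))"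
    using argmax_set_nonempty[OF assms(1)] by blast
  then have ax: "a \<in> argmax_set A lam x" using t by blast
  have "teval A lam (x + t *\<^sub>R (-u)) = teval A lam x - t * (u \<bullet> rvec a)"
    using a ax by (auto simp: argmax_set_def inner_add_right inner_diff_right inner_commute)
  also have "\<dots> < teval A lam x - t * (u \<bullet> p)"
    using u(1) u(2)[OF rvec_mem_dual_cell[OF ax]] t(1) by simp
  also have "\<dots> \<le> teval A lam (x + t *\<^sub>R (-u))"
    using sub[of "x + t *\<^sub>R (-u)"] by (simp add: inner_commute)
  finally show False by simp
qed

text \<open>A common subgradient satisfies the subgradient inequality from \<open>x\<close> to
  \<open>y\<close> and from \<open>y\<close> to \<open>x\<close>; together they are an equality.
  Thus cells of distinct points overlap in a null set.\<close>

lemma dual_cell_Int_subset_hyperplane: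
  assumes "tpoly A"
  shows "dual_cell A lam x \<inter> dual_cell A lam y \<subseteq>
         {p. (y - x) \<bullet> p = teval A lam y - teval A lam x}"
proof clarify
  fix p assume p: "p \<in> dual_cell A lam x" "p \<in> dual_cell A lam y"
  then show "(y - x) \<bullet> p = teval A lam y - teval A lam x"
    using dual_cell_imp_subgradient[OF assms p(1), of y]
      dual_cell_imp_subgradient[OF assms p(2), of x]
    by (simp add: inner_diff_right inner_diff_left inner_commute)
qed

lemma dual_cell_full_dim_inject:
  assumes "tpoly A" "aff_dim (dual_cell A lam x) = int CARD('m)"
    and "dual_cell A lam x = dual_cell A lam (y :: real^'m)"
  shows "x = y"
proof (rule ccontr)
  assume "x \<noteq> y"
  have "dual_cell A lam x \<subseteq> {p. (y - x) \<bullet> p = teval A lam y - teval A lam x}"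
    using dual_cell_Int_subset_hyperplane[OF assms(1), of lam x y] assms(3) by simp
  then have "aff_dim (dual_cell A lam x) \<le> aff_dim {p. (y - x) \<bullet> p = teval A lam y - teval A lam x}"
    by (rule aff_dim_subset)
  also have "\<dots> = int CARD('m) - 1"
    using \<open>x \<noteq> y\<close> by (simp add: aff_dim_hyperplane)
  finally show False using assms(2) by simp
qed

section \<open>Tiling of the Newton polytope by full-dimensional cells\<close>

lemma continuous_on_teval:
  assumes "tpoly A"
  shows "continuous_on S (teval A lam)"
proof -
  have "finite A" "A \<noteq> {}" using assms by (auto simp: tpoly_def)
  then show ?thesis
  proof (induction rule: finite_ne_induct)
    case (singleton a)
    then show ?case by (auto simp: teval_def[abs_def] intro!: continuous_intros)
  next
    case (insert a F)
    have "teval (insert a F) lam = (\<lambda>x. max (lam a + rvec a \<bullet> x) (teval F lam x))"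
      using insert.hyps by (auto simp: teval_def[abs_def])
    then show ?case using insert.IH by (auto intro!: continuous_intros)
  qed
qed

text \<open>For \<open>p\<close> in the interior, \<open>teval A lam y - p \<bullet> y\<close> grows
  at least linearly in \<open>norm y\<close>, hence has a global minimum; at a minimiser,
  \<open>p\<close> is a subgradient.\<close>

lemma interior_newton_polytope_subset:
  assumes "tpoly A"
  shows "interior (newton_polytope A) \<subseteq> (\<Union>x. dual_cell A lam x)"
proof
  fix p assume "p \<in> interior (newton_polytope A)"
  then obtain e where e: "e > 0" "cball p e \<subseteq> newton_polytope A"
    by (meson mem_interior_cball)
  have fin: "finite A" using assms by (simp add: tpoly_def)
  \<comment> \<open>With the least coefficient \<open>L\<close>, the support function of the Newton
    polytope plus \<open>L\<close> is a lower bound for \<open>teval A lam\<close>.\<close>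
  define L where "L = Min (lam ` A)"
  have support: "z \<bullet> y \<le> teval A lam y - L" if "z \<in> newton_polytope A" for z y
  proof -
    have "newton_polytope A \<subseteq> {q. y \<bullet> q \<le> teval A lam y - L}"
      unfolding newton_polytope_def
    proof (intro hull_minimal convex_halfspace_le, clarify)
      fix a assume "a \<in> A"
      moreover from this have "L \<le> lam a" using fin by (simp add: L_def)
      ultimately show "y \<bullet> rvec a \<le> teval A lam y - L"
        using teval_ge[OF fin, of a lam y] by (simp add: inner_commute)
    qed
    then show ?thesis using that by (auto simp: inner_commute)
  qed
  let ?h = "\<lambda>y. teval A lam y - p \<bullet> y"
  have coercive: "L + e * norm y \<le> ?h y" for y
  proof (cases "y = 0")
    case True
    then show ?thesis using support[of p 0] e by (auto simp: subset_iff)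
  next
    case False
    \<comment> \<open>The point of the ball that is extreme in direction \<open>y\<close> gives the
      slope \<open>e\<close>.\<close>
    have "p + (e / norm y) *\<^sub>R y \<in> cball p e" using e False by (simp add: dist_norm)
    then have "(p + (e / norm y) *\<^sub>R y) \<bullet> y \<le> teval A lam y - L" using e support by blast
    then show ?thesis using False
      by (simp add: inner_add_left power2_norm_eq_inner[symmetric] power2_eq_square)
  qed
  \<comment> \<open>Beyond this radius the linear bound exceeds the value at 0, so the minimum over
    the ball is global.\<close>
  define R where "R = (?h 0 - L) / e"
  have "R \<ge> 0" using coercive[of 0] e by (simp add: R_def)
  have "continuous_on (cball 0 R) ?h"
    by (intro continuous_intros continuous_on_teval assms)
  then obtain x where x: "x \<in> cball 0 R" "\<And>y. y \<in> cball 0 R \<Longrightarrow> ?h x \<le> ?h y"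
    using continuous_attains_inf[of "cball 0 R" ?h] \<open>R \<ge> 0\<close> by auto
  have "?h x \<le> ?h y" for y
  proof (cases "y \<in> cball 0 R")
    case False
    then have "R < norm y" by simp
    then have "?h 0 < L + e * norm y" using e by (simp add: R_def field_simps)
    then show ?thesis using coercive[of y] x(2)[of 0] \<open>R \<ge> 0\<close> by simp
  qed (use x in auto)
  then have "p \<in> dual_cell A lam x"
    by (intro subgradient_imp_dual_cell[OF assms]) (simp add: inner_diff_right algebra_simps)
  then show "p \<in> (\<Union>x. dual_cell A lam x)" by blast
qed

text \<open>Full-dimensional cells are recorded by their dual points. By
  \<open>dual_cell_full_dim_inject\<close> each such cell has exactly one, so sums over this set
  count every maximal cell once.\<close>

definition full_cells :: "(int^'m) set \<Rightarrow> (int^'m \<Rightarrow> real) \<Rightarrow> (real^'m) set" where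
  "full_cells A lam = {x. aff_dim (dual_cell A lam x) = int CARD('m)}"

lemma finite_range_dual_cell:
  assumes "tpoly A"
  shows "finite (range (dual_cell A lam))"
proof -
  have "range (dual_cell A lam) \<subseteq> (\<lambda>B. convex hull (rvec ` B)) ` Pow A"
    by (auto simp: dual_cell_def argmax_set_def)
  moreover have "finite (Pow A)" using assms by (simp add: tpoly_def)
  ultimately show ?thesis using finite_subset by blast
qed

lemma finite_full_cells:
  assumes "tpoly A"
  shows "finite (full_cells A lam)"
proof -
  have "inj_on (dual_cell A lam) (full_cells A lam)"
    using dual_cell_full_dim_inject[OF assms] by (auto simp: inj_on_def full_cells_def)
  then show ?thesis
    using finite_range_dual_cell[OF assms] by (meson finite_imageD finite_subset image_mono subset_UNIV)
qed

text \<open>The full-dimensional cells cover the polytope except for part of its frontier and of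
  finitely many lower-dimensional cells, and they overlap in subsets of hyperplanes.\<close>

lemma measure_newton_polytope:
  fixes A :: "(int^'m) set"
  assumes "tpoly A"
  shows "measure lebesgue (newton_polytope A) =
         (\<Sum>x\<in>full_cells A lam. measure lebesgue (dual_cell A lam x))"
proof -
  let ?N = "newton_polytope A" and ?U = "\<Union>(dual_cell A lam ` full_cells A lam)"
  have comp: "compact ?N"
    using assms unfolding newton_polytope_def tpoly_def
    by (intro compact_convex_hull finite_imp_compact) auto
  have conv: "convex ?N" by (simp add: newton_polytope_def)
  \<comment> \<open>The union runs over cells, not over points \<open>x\<close>: there are only
    finitely many cells, so negligibility passes to the union.\<close>
  let ?L = "\<Union>{S \<in> range (dual_cell A lam). aff_dim S < int CARD('m)}"
  have "?N - ?U \<subseteq> frontier ?N \<union> ?L"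
  proof
    fix p assume p: "p \<in> ?N - ?U"
    show "p \<in> frontier ?N \<union> ?L"
    proof (cases "p \<in> interior ?N")
      case True
      then obtain x where x: "p \<in> dual_cell A lam x"
        using interior_newton_polytope_subset[OF assms] by blast
      then have "aff_dim (dual_cell A lam x) \<noteq> int CARD('m)"
        using p by (auto simp: full_cells_def)
      moreover have "aff_dim (dual_cell A lam x) \<le> int CARD('m)"
        using aff_dim_le_DIM[of "dual_cell A lam x"] by simp
      ultimately show ?thesis using x by auto
    qed (use p comp in \<open>auto simp: frontier_def compact_imp_closed\<close>)
  qed
  moreover have "negligible (frontier ?N \<union> ?L)"
  proof (intro negligible_Un negligible_convex_frontier conv negligible_Union)
    show "finite {S \<in> range (dual_cell A lam). aff_dim S < int CARD('m)}"
      using finite_range_dual_cell[OF assms] by simp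
    fix S assume "S \<in> {S \<in> range (dual_cell A lam). aff_dim S < int CARD('m)}"
    then have "aff_dim S < int DIM(real^'m)" by simp
    then obtain a b where "a \<noteq> 0" "S \<subseteq> {x. a \<bullet> x = b}"
      using aff_lowdim_subset_hyperplane by metis
    then show "negligible S" using negligible_subset[OF negligible_hyperplane[of a b]] by blast
  qed
  ultimately have "negligible (?N - ?U)" by (rule negligible_subset[rotated])
  moreover have "?U - ?N = {}" using dual_cell_subset_newton_polytope by blast
  ultimately have "negligible (?N - ?U \<union> (?U - ?N))" by simp
  then have "measure lebesgue ?N = measure lebesgue ?U"
    using measure_negligible_symdiff[OF lmeasurable_compact[OF comp]] by metis
  also have "\<dots> = (\<Sum>x\<in>full_cells A lam. measure lebesgue (dual_cell A lam x))"
  proof (intro measure_negligible_finite_Union_image finite_full_cells assms)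
    show "dual_cell A lam x \<in> lmeasurable" for x
      by (intro lmeasurable_compact compact_dual_cell assms)
    show "pairwise (\<lambda>x y. negligible (dual_cell A lam x \<inter> dual_cell A lam y)) (full_cells A lam)"
    proof (rule pairwiseI)
      fix x y :: "real^'m" assume "x \<noteq> y"
      then show "negligible (dual_cell A lam x \<inter> dual_cell A lam y)"
        by (intro negligible_subset[OF negligible_hyperplane
            dual_cell_Int_subset_hyperplane[OF assms]]) auto
    qed
  qed
  finally show ?thesis .
qed

subsection \<open>Products of tropical polynomials\<close>

lemma rvec_sum: "rvec (\<Sum>i\<in>J. a i) = (\<Sum>i\<in>J. rvec (a i))"
  by (simp add: rvec_def vec_eq_iff)

lemma rvec_image_prodA:
  assumes "finite J"
  shows "rvec ` prodA J A = (\<Sum>i\<in>J. rvec ` A i)"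
proof
  show "rvec ` prodA J A \<subseteq> (\<Sum>i\<in>J. rvec ` A i)"
    unfolding set_sum_alt[OF assms]
  proof clarify
    fix b assume "b \<in> prodA J A"
    then obtain a where a: "b = (\<Sum>i\<in>J. a i)" "\<forall>i\<in>J. a i \<in> A i" by (auto simp: prodA_def)
    then show "\<exists>s. rvec b = sum s J \<and> (\<forall>i\<in>J. s i \<in> rvec ` A i)"
      by (intro exI[of _ "\<lambda>i. rvec (a i)"]) (simp add: rvec_sum)
  qed
  show "(\<Sum>i\<in>J. rvec ` A i) \<subseteq> rvec ` prodA J A"
    unfolding set_sum_alt[OF assms]
  proof clarify
    fix s assume "\<forall>i\<in>J. s i \<in> rvec ` A i"
    then have "\<forall>i\<in>J. \<exists>b. b \<in> A i \<and> s i = rvec b" by blast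
    then obtain a where a: "\<forall>i\<in>J. a i \<in> A i \<and> s i = rvec (a i)" by metis
    then have "sum s J = rvec (\<Sum>i\<in>J. a i)" by (simp add: rvec_sum)
    moreover have "(\<Sum>i\<in>J. a i) \<in> prodA J A" using a by (auto simp: prodA_def)
    ultimately show "sum s J \<in> rvec ` prodA J A" by blast
  qed
qed

text \<open>Only the values on \<open>J\<close> matter; extensional functions leave finitely many
  choices when \<open>J\<close> and the supports are finite.\<close>

lemma prodA_eq_image_PiE: "prodA J A = (\<lambda>a. \<Sum>i\<in>J. a i) ` (\<Pi>\<^sub>E i\<in>J. A i)"
proof
  show "prodA J A \<subseteq> (\<lambda>a. \<Sum>i\<in>J. a i) ` (\<Pi>\<^sub>E i\<in>J. A i)"
    unfolding prodA_def
  proof clarify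
    fix a assume "\<forall>i\<in>J. a i \<in> A i"
    then show "(\<Sum>i\<in>J. a i) \<in> (\<lambda>a. \<Sum>i\<in>J. a i) ` (\<Pi>\<^sub>E i\<in>J. A i)"
      by (intro image_eqI[of _ _ "restrict a J"]) auto
  qed
qed (auto simp: prodA_def)

lemma tpoly_prodA:
  assumes "finite J" "\<And>i. i \<in> J \<Longrightarrow> tpoly (A i)"
  shows "tpoly (prodA J A)"
proof -
  have "finite (\<Pi>\<^sub>E i\<in>J. A i)" "(\<Pi>\<^sub>E i\<in>J. A i) \<noteq> {}"
    using assms by (auto simp: tpoly_def PiE_eq_empty_iff intro!: finite_PiE)
  then show ?thesis by (simp add: tpoly_def prodA_eq_image_PiE)
qed

lemma finite_lam_sums:
  assumes "finite J" "\<And>i. i \<in> J \<Longrightarrow> tpoly (A i)"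
  shows "finite {(\<Sum>i\<in>J. lam i (a i)) | a. (\<forall>i\<in>J. a i \<in> A i) \<and> (\<Sum>i\<in>J. a i) = b}"
proof (rule finite_subset)
  show "{(\<Sum>i\<in>J. lam i (a i)) | a. (\<forall>i\<in>J. a i \<in> A i) \<and> (\<Sum>i\<in>J. a i) = b}
      \<subseteq> (\<lambda>a. \<Sum>i\<in>J. lam i (a i)) ` (\<Pi>\<^sub>E i\<in>J. A i)"
  proof clarify
    fix a assume "\<forall>i\<in>J. a i \<in> A i"
    then show "(\<Sum>i\<in>J. lam i (a i)) \<in> (\<lambda>a. \<Sum>i\<in>J. lam i (a i)) ` (\<Pi>\<^sub>E i\<in>J. A i)"
      by (intro image_eqI[of _ _ "restrict a J"]) auto
  qed
  show "finite ((\<lambda>a. \<Sum>i\<in>J. lam i (a i)) ` (\<Pi>\<^sub>E i\<in>J. A i))"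
    using assms by (intro finite_imageI finite_PiE) (auto simp: tpoly_def)
qed

lemma prodlam_ge:
  assumes "finite J" "\<And>i. i \<in> J \<Longrightarrow> tpoly (A i)" "\<And>i. i \<in> J \<Longrightarrow> a i \<in> A i"
  shows "(\<Sum>i\<in>J. lam i (a i)) \<le> prodlam J A lam (\<Sum>i\<in>J. a i)"
  unfolding prodlam_def using assms by (intro Max_ge finite_lam_sums) auto

lemma prodlam_attained:
  assumes "finite J" "\<And>i. i \<in> J \<Longrightarrow> tpoly (A i)" "b \<in> prodA J A"
  shows "\<exists>a. (\<forall>i\<in>J. a i \<in> A i) \<and> (\<Sum>i\<in>J. a i) = b \<and> prodlam J A lam b = (\<Sum>i\<in>J. lam i (a i))"
proof -
  have "prodlam J A lam b \<in> {(\<Sum>i\<in>J. lam i (a i)) | a. (\<forall>i\<in>J. a i \<in> A i) \<and> (\<Sum>i\<in>J. a i) = b}"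
    unfolding prodlam_def
    using assms(3) by (intro Max_in finite_lam_sums assms(1,2)) (auto simp: prodA_def)
  then show ?thesis by blast
qed

lemma sum_affine_rvec:
  "(\<Sum>i\<in>J. lam i (a i) + rvec (a i) \<bullet> x) = (\<Sum>i\<in>J. lam i (a i)) + rvec (\<Sum>i\<in>J. a i) \<bullet> x"
  by (simp add: sum.distrib rvec_sum inner_sum_left)

lemma teval_prod_le:
  assumes "finite J" "\<And>i. i \<in> J \<Longrightarrow> tpoly (A i)" "\<And>i. i \<in> J \<Longrightarrow> a i \<in> argmax_set (A i) (lam i) x"
  shows "(\<Sum>i\<in>J. teval (A i) (lam i) x) \<le>
         prodlam J A lam (\<Sum>i\<in>J. a i) + rvec (\<Sum>i\<in>J. a i) \<bullet> x"
proof -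
  have "(\<Sum>i\<in>J. teval (A i) (lam i) x) = (\<Sum>i\<in>J. lam i (a i) + rvec (a i) \<bullet> x)"
    using assms(3) by (intro sum.cong) (auto simp: argmax_set_def)
  also have "\<dots> \<le> prodlam J A lam (\<Sum>i\<in>J. a i) + rvec (\<Sum>i\<in>J. a i) \<bullet> x"
    unfolding sum_affine_rvec[of lam a x J]
    using prodlam_ge[of J A a lam, OF assms(1,2) _] assms(3)
    by (simp add: argmax_set_def)
  finally show ?thesis .
qed

lemma sum_mem_prodA: "(\<And>i. i \<in> J \<Longrightarrow> a i \<in> A i) \<Longrightarrow> (\<Sum>i\<in>J. a i) \<in> prodA J A"
  by (auto simp: prodA_def)

text \<open>The exponents of the factors are chosen independently, so the maximum of the sums is the
  sum of the maxima.\<close>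

lemma teval_prod:
  assumes "finite J" "\<And>i. i \<in> J \<Longrightarrow> tpoly (A i)"
  shows "teval (prodA J A) (prodlam J A lam) x = (\<Sum>i\<in>J. teval (A i) (lam i) x)"
proof (rule antisym)
  have "tpoly (prodA J A)" using assms by (rule tpoly_prodA)
  from argmax_set_nonempty[OF this]
  obtain b where b: "b \<in> argmax_set (prodA J A) (prodlam J A lam) x" by blast
  then have "b \<in> prodA J A" by (simp add: argmax_set_def)
  from prodlam_attained[of J A b lam, OF assms this]
  obtain a where a: "\<forall>i\<in>J. a i \<in> A i" "(\<Sum>i\<in>J. a i) = b"
    "prodlam J A lam b = (\<Sum>i\<in>J. lam i (a i))"
    by blast
  have "teval (prodA J A) (prodlam J A lam) x = prodlam J A lam b + rvec b \<bullet> x"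
    using b by (simp add: argmax_set_def)
  also have "\<dots> = (\<Sum>i\<in>J. lam i (a i) + rvec (a i) \<bullet> x)"
    using sum_affine_rvec[of lam a x J] a(2,3) by simp
  also have "\<dots> \<le> (\<Sum>i\<in>J. teval (A i) (lam i) x)"
  proof (rule sum_mono)
    show "lam i (a i) + rvec (a i) \<bullet> x \<le> teval (A i) (lam i) x" if "i \<in> J" for i
      using a(1)[rule_format, OF that] assms(2)[OF that] by (intro teval_ge) (simp_all add: tpoly_def)
  qed
  finally show "teval (prodA J A) (prodlam J A lam) x \<le> (\<Sum>i\<in>J. teval (A i) (lam i) x)" .
next
  have "\<forall>i\<in>J. \<exists>b. b \<in> argmax_set (A i) (lam i) x"
    using argmax_set_nonempty[OF assms(2)] by (simp add: ex_in_conv)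
  then obtain a where a: "\<And>i. i \<in> J \<Longrightarrow> a i \<in> argmax_set (A i) (lam i) x"
    by metis
  then have "(\<Sum>i\<in>J. a i) \<in> prodA J A"
    by (intro sum_mem_prodA) (simp add: argmax_set_def)
  then have "prodlam J A lam (\<Sum>i\<in>J. a i) + rvec (\<Sum>i\<in>J. a i) \<bullet> x
      \<le> teval (prodA J A) (prodlam J A lam) x"
    using tpoly_prodA[of J A, OF assms] by (intro teval_ge) (simp_all add: tpoly_def)
  then show "(\<Sum>i\<in>J. teval (A i) (lam i) x) \<le> teval (prodA J A) (prodlam J A lam) x"
    using teval_prod_le[of J A a lam x, OF assms a] by linarith
qed

lemma argmax_set_prod:
  assumes "finite J" "\<And>i. i \<in> J \<Longrightarrow> tpoly (A i)"
  shows "argmax_set (prodA J A) (prodlam J A lam) x = prodA J (\<lambda>i. argmax_set (A i) (lam i) x)"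
proof
  show "argmax_set (prodA J A) (prodlam J A lam) x \<subseteq> prodA J (\<lambda>i. argmax_set (A i) (lam i) x)"
  proof
    fix b assume b: "b \<in> argmax_set (prodA J A) (prodlam J A lam) x"
    then have "b \<in> prodA J A" by (simp add: argmax_set_def)
    from prodlam_attained[of J A b lam, OF assms this]
    obtain a where a: "\<forall>i\<in>J. a i \<in> A i" "(\<Sum>i\<in>J. a i) = b"
      "prodlam J A lam b = (\<Sum>i\<in>J. lam i (a i))"
      by blast
    have "(\<Sum>i\<in>J. lam i (a i) + rvec (a i) \<bullet> x) = prodlam J A lam b + rvec b \<bullet> x"
      using sum_affine_rvec[of lam a x J] a(2,3) by simp
    also have "\<dots> = teval (prodA J A) (prodlam J A lam) x"
      using b by (simp add: argmax_set_def)
    also have "\<dots> = (\<Sum>i\<in>J. teval (A i) (lam i) x)"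
      by (rule teval_prod[OF assms])
    finally have eq: "(\<Sum>i\<in>J. lam i (a i) + rvec (a i) \<bullet> x) = (\<Sum>i\<in>J. teval (A i) (lam i) x)" .
    \<comment> \<open>Termwise bounds whose sums agree are termwise equalities, so every summand is
      a maximiser of its own factor.\<close>
    have "lam i (a i) + rvec (a i) \<bullet> x = teval (A i) (lam i) x" if "i \<in> J" for i
    proof (rule sum_mono_inv[OF eq _ that assms(1)])
      show "lam j (a j) + rvec (a j) \<bullet> x \<le> teval (A j) (lam j) x" if "j \<in> J" for j
        using a(1)[rule_format, OF that] assms(2)[OF that] by (intro teval_ge) (simp_all add: tpoly_def)
    qed
    then show "b \<in> prodA J (\<lambda>i. argmax_set (A i) (lam i) x)"
      using a(1,2) by (auto simp: prodA_def argmax_set_def)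
  qed
  show "prodA J (\<lambda>i. argmax_set (A i) (lam i) x) \<subseteq> argmax_set (prodA J A) (prodlam J A lam) x"
  proof
    fix b assume "b \<in> prodA J (\<lambda>i. argmax_set (A i) (lam i) x)"
    then obtain a where a: "\<And>i. i \<in> J \<Longrightarrow> a i \<in> argmax_set (A i) (lam i) x" "b = (\<Sum>i\<in>J. a i)"
      by (auto simp: prodA_def)
    have mem: "b \<in> prodA J A"
      unfolding a(2) using a(1) by (intro sum_mem_prodA) (simp add: argmax_set_def)
    then have "prodlam J A lam b + rvec b \<bullet> x \<le> teval (prodA J A) (prodlam J A lam) x"
      using tpoly_prodA[of J A, OF assms] by (intro teval_ge) (simp_all add: tpoly_def)
    moreover have "teval (prodA J A) (prodlam J A lam) x \<le> prodlam J A lam b + rvec b \<bullet> x"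
      using teval_prod_le[of J A a lam x] a assms by (simp add: teval_prod)
    ultimately show "b \<in> argmax_set (prodA J A) (prodlam J A lam) x"
      using mem by (simp add: argmax_set_def)
  qed
qed

text \<open>This is the privileged representation of a cell: maximisers of the product are the sums
  of maximisers of the factors, and convex hulls commute with Minkowski sums.\<close>

lemma dual_cell_prod:
  assumes "finite J" "\<And>i. i \<in> J \<Longrightarrow> tpoly (A i)"
  shows "dual_cell (prodA J A) (prodlam J A lam) x = (\<Sum>i\<in>J. dual_cell (A i) (lam i) x)"
proof -
  have "dual_cell (prodA J A) (prodlam J A lam) x =
      convex hull (rvec ` prodA J (\<lambda>i. argmax_set (A i) (lam i) x))"
    unfolding dual_cell_def using argmax_set_prod[of J A lam x] assms by simp
  then show ?thesis
    by (simp add: rvec_image_prodA[OF assms(1)] convex_hull_set_sum dual_cell_def)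
qed

lemma newton_polytope_prodA:
  assumes "finite J"
  shows "newton_polytope (prodA J A) = (\<Sum>i\<in>J. newton_polytope (A i))"
  by (simp add: newton_polytope_def rvec_image_prodA[OF assms] convex_hull_set_sum)

lemma sum_singletons: "(\<Sum>i\<in>J. {c i}) = {\<Sum>i\<in>J. c i :: 'a :: comm_monoid_add}"
  by (induction J rule: infinite_finite_induct) (auto simp: set_plus_def)

lemma dual_cell_prod_translation:
  assumes "finite J" "\<And>i. i \<in> J \<Longrightarrow> tpoly (A i)" "K \<subseteq> J"
    and "\<And>i. i \<in> J - K \<Longrightarrow> dual_cell (A i) (lam i) x = {c i}"
  shows "dual_cell (prodA J A) (prodlam J A lam) x =
         (+) (\<Sum>i\<in>J - K. c i) ` dual_cell (prodA K A) (prodlam K A lam) x"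
proof -
  have K: "finite K" "\<And>i. i \<in> K \<Longrightarrow> tpoly (A i)" using assms finite_subset by auto
  have "(\<Sum>i\<in>J. dual_cell (A i) (lam i) x) =
      (\<Sum>i\<in>J - K. dual_cell (A i) (lam i) x) + (\<Sum>i\<in>K. dual_cell (A i) (lam i) x)"
    using sum.subset_diff[OF assms(3,1)] .
  also have "(\<Sum>i\<in>J - K. dual_cell (A i) (lam i) x) = {\<Sum>i\<in>J - K. c i}"
    using assms(4) by (simp add: sum_singletons[symmetric])
  finally show ?thesis
    using assms(1,2) K by (simp add: dual_cell_prod translation_eq_singleton_plus)
qed

section \<open>Minkowski sums and volumes of standard simplices\<close>

lemma std_simplex_eq_scaling: "std_simplex d = (*\<^sub>R) (real d) ` (std_simplex 1 :: (real^'m) set)"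
  unfolding std_simplex_def
  by (subst convex_hull_scaling[symmetric]) (simp add: image_image)

text \<open>For two summands, convexity merges \<open>s *\<^sub>R u + t *\<^sub>R v\<close> into
  \<open>s + t\<close> times a point of \<open>S\<close>. Nonemptiness of \<open>S\<close> matches
  the empty sum, which is \<open>{0}\<close>.\<close>

lemma convex_scaling_sum:
  fixes S :: "'a::real_vector set"
  assumes "convex S" "S \<noteq> {}" "\<And>i. i \<in> J \<Longrightarrow> c i \<ge> 0"
  shows "(\<Sum>i\<in>J. (*\<^sub>R) (c i) ` S) = (*\<^sub>R) (\<Sum>i\<in>J. c i) ` S"
  using assms(3)
proof (induction J rule: infinite_finite_induct)
  case (insert i J)
  have "(*\<^sub>R) s ` S + (*\<^sub>R) t ` S = (*\<^sub>R) (s + t) ` S" if st: "s \<ge> 0" "t \<ge> 0" for s t :: real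
  proof
    show "(*\<^sub>R) (s + t) ` S \<subseteq> (*\<^sub>R) s ` S + (*\<^sub>R) t ` S"
      by (auto simp: scaleR_left_distrib)
    show "(*\<^sub>R) s ` S + (*\<^sub>R) t ` S \<subseteq> (*\<^sub>R) (s + t) ` S"
    proof
      fix z assume "z \<in> (*\<^sub>R) s ` S + (*\<^sub>R) t ` S"
      then obtain u v where uv: "u \<in> S" "v \<in> S" "z = s *\<^sub>R u + t *\<^sub>R v"
        by (auto elim!: set_plus_elim)
      show "z \<in> (*\<^sub>R) (s + t) ` S"
      proof (cases "s + t = 0")
        case True
        then have "s = 0" "t = 0" using st by auto
        then show ?thesis using uv by auto
      next
        case False
        then have "(s / (s + t)) *\<^sub>R u + (t / (s + t)) *\<^sub>R v \<in> S"
          using st uv by (intro convexD[OF assms(1)]) (auto simp: add_divide_distrib[symmetric])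
        moreover have "z = (s + t) *\<^sub>R ((s / (s + t)) *\<^sub>R u + (t / (s + t)) *\<^sub>R v)"
          using False by (simp add: uv(3) scaleR_right_distrib)
        ultimately show ?thesis by blast
      qed
    qed
  qed
  moreover have "(\<Sum>j\<in>J. c j) \<ge> 0" using insert.prems by (intro sum_nonneg) auto
  ultimately show ?case using insert by simp
qed (use assms(2) in \<open>auto simp: image_constant_conv\<close>)

lemma sum_std_simplex:
  "(\<Sum>i\<in>J. std_simplex (d i)) = (std_simplex (\<Sum>i\<in>J. d i) :: (real^'m) set)"
proof -
  have "(\<Sum>i\<in>J. std_simplex (d i)) = (\<Sum>i\<in>J. (*\<^sub>R) (real (d i)) ` (std_simplex 1 :: (real^'m) set))"
    by (intro sum.cong std_simplex_eq_scaling refl)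
  also have "\<dots> = (*\<^sub>R) (\<Sum>i\<in>J. real (d i)) ` (std_simplex 1 :: (real^'m) set)"
    by (rule convex_scaling_sum) (auto simp: std_simplex_def)
  also have "\<dots> = std_simplex (\<Sum>i\<in>J. d i)"
    by (subst (2) std_simplex_eq_scaling) simp
  finally show ?thesis .
qed

lemma measure_std_simplex:
  "measure lebesgue (std_simplex d :: (real^'m) set) = real d ^ CARD('m) / fact CARD('m)"
proof -
  \<comment> \<open>The unit vectors are the library's \<open>Basis\<close>, which gives access to
    the known volume of the unit simplex.\<close>
  have B: "((\<lambda>k. axis k 1) ` UNIV :: (real^'m) set) = Basis"
    by (auto simp: Basis_vec_def)
  have "measure lebesgue (std_simplex d :: (real^'m) set) =
      real d ^ CARD('m) * measure lebesgue (std_simplex 1 :: (real^'m) set)"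
    using measure_lebesgue_affine[of "real d" 0 "std_simplex 1 :: (real^'m) set"]
    by (subst std_simplex_eq_scaling) simp
  also have "measure lebesgue (std_simplex 1 :: (real^'m) set) = 1 / fact CARD('m)"
    using content_std_simplex[where 'a = "real^'m"]
    by (simp add: std_simplex_def B measure_completion compact_convex_hull finite_imp_compact compact_imp_closed)
  finally show ?thesis by simp
qed

section \<open>Points of a hypersurface and their dual cells\<close>

lemma trop_hyp_iff:
  assumes "tpoly A"
  shows "x \<in> trop_hyp A lam \<longleftrightarrow> \<not> (\<exists>a. argmax_set A lam x = {a})"
proof -
  have "\<exists>e>0. \<exists>v c. \<forall>y\<in>ball x e. teval A lam y = v \<bullet> y + c" if a: "argmax_set A lam x = {a}" for a
  proof -
    obtain e where e: "e > 0" "\<And>y. y \<in> ball x e \<Longrightarrow> argmax_set A lam y \<subseteq> {a}"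
      using eventually_argmax_set_subset[OF assms, of lam x] a
      by (auto simp: eventually_nhds_metric dist_commute)
    have "teval A lam y = rvec a \<bullet> y + lam a" if "y \<in> ball x e" for y
      using e(2)[OF that] argmax_set_nonempty[OF assms, of lam y] by (auto simp: argmax_set_def)
    then show ?thesis using e(1) by blast
  qed
  moreover have "\<exists>a. argmax_set A lam x = {a}"
    if e: "e > 0" and affine: "\<forall>y\<in>ball x e. teval A lam y = v \<bullet> y + c" for e v c
  proof -
    have "rvec a = v" if "a \<in> argmax_set A lam x" for a
    proof (rule ccontr)
      assume "rvec a \<noteq> v"
      \<comment> \<open>Along \<open>w\<close> the term of \<open>a\<close> grows faster than the
        affine function with gradient \<open>v\<close>; the step \<open>t\<close> stays at half the
        radius of the ball.\<close>
      define w where "w = rvec a - v"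
      define t where "t = e / (2 * norm w)"
      have w: "w \<noteq> 0" "t > 0" using \<open>rvec a \<noteq> v\<close> e by (auto simp: w_def t_def)
      then have "x + t *\<^sub>R w \<in> ball x e" using e by (simp add: dist_norm t_def)
      then have "lam a + rvec a \<bullet> (x + t *\<^sub>R w) \<le> v \<bullet> (x + t *\<^sub>R w) + c"
        using affine teval_ge[of A a lam "x + t *\<^sub>R w"] assms that
        by (auto simp: argmax_set_def tpoly_def)
      moreover have "lam a + rvec a \<bullet> x = v \<bullet> x + c"
        using that affine e by (simp add: argmax_set_def)
      ultimately have "t * (w \<bullet> w) \<le> 0"
        by (simp add: inner_add_right w_def inner_diff_left algebra_simps)
      moreover have "t * (w \<bullet> w) > 0" using w by simp
      ultimately show False by linarith
    qed
    moreover obtain a where "a \<in> argmax_set A lam x" using argmax_set_nonempty[OF assms] by blast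
    ultimately have "argmax_set A lam x = {a}" using rvec_inject by blast
    then show ?thesis by blast
  qed
  ultimately show ?thesis unfolding trop_hyp_def by blast
qed

text \<open>A cell of dimension 0 is a single point, which would leave only one maximising
  exponent.\<close>

lemma aff_dim_dual_cell_pos:
  assumes "tpoly A" "x \<in> trop_hyp A lam"
  shows "aff_dim (dual_cell A lam x) \<ge> 1"
proof -
  have "aff_dim (dual_cell A lam x) \<noteq> 0"
  proof
    assume "aff_dim (dual_cell A lam x) = 0"
    then obtain c where "dual_cell A lam x = {c}" by (auto simp: aff_dim_eq_0)
    then have "\<And>a. a \<in> argmax_set A lam x \<Longrightarrow> rvec a = c" using rvec_mem_dual_cell by blast
    moreover obtain a where "a \<in> argmax_set A lam x" using argmax_set_nonempty[OF assms(1)] by blast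
    ultimately have "argmax_set A lam x = {a}" using rvec_inject by blast
    then show False using assms by (simp add: trop_hyp_iff)
  qed
  moreover have "aff_dim (dual_cell A lam x) \<ge> 0"
    using dual_cell_nonempty[OF assms(1), of lam x] aff_dim_negative_iff[of "dual_cell A lam x"] by linarith
  ultimately show ?thesis by linarith
qed

subsection \<open>Strata of a transversal arrangement\<close>

text \<open>Extends the dimension formula of transversality to fewer than two indices: for one index
  both sides coincide, and the empty product has the cell \<open>{0}\<close> of dimension 0.\<close>

lemma aff_dim_dual_cell_prod:
  fixes A :: "nat \<Rightarrow> (int^'m) set"
  assumes "transversal I A lam" "\<And>i. i \<in> I \<Longrightarrow> tpoly (A i)" "finite K" "K \<subseteq> I"
    and "x \<in> inter_J K A lam"
  shows "aff_dim (dual_cell (prodA K A) (prodlam K A lam) x) =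
         (\<Sum>i\<in>K. aff_dim (dual_cell (A i) (lam i) x))"
proof (cases "card K \<ge> 2")
  case True
  then show ?thesis using assms by (auto simp: transversal_def)
next
  case False
  then have "card K = 0 \<or> card K = 1" by linarith
  then have "K = {} \<or> (\<exists>k. K = {k})" using assms(3) by (auto simp: card_1_singleton_iff)
  moreover have "dual_cell (prodA K A) (prodlam K A lam) x = (\<Sum>i\<in>K. dual_cell (A i) (lam i) x)"
    using assms(2-4) by (intro dual_cell_prod) auto
  ultimately show ?thesis by (auto simp: set_zero)
qed

text \<open>The dual points of the tiles of type \<open>K\<close>. The definition refers to
  \<open>K\<close> alone and to no larger index set, as Moebius inversion over the subsets
  requires.\<close>

definition stratum :: "nat set \<Rightarrow> (nat \<Rightarrow> (int^'m) set) \<Rightarrow> (nat \<Rightarrow> int^'m \<Rightarrow> real)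
                        \<Rightarrow> (real^'m) set" where
  "stratum K A lam = inter_J K A lam \<inter> full_cells (prodA K A) (prodlam K A lam)"

text \<open>A further hypersurface through \<open>x\<close> would add at least 1 to the dimension of
  a product cell that already fills the space.\<close>

lemma stratum_not_in_other_hyp:
  fixes A :: "nat \<Rightarrow> (int^'m) set"
  assumes "transversal I A lam" "\<And>i. i \<in> I \<Longrightarrow> tpoly (A i)" "finite K" "K \<subseteq> I"
    and "x \<in> stratum K A lam" "i \<in> I - K"
  shows "x \<notin> trop_hyp (A i) (lam i)"
proof
  assume xi: "x \<in> trop_hyp (A i) (lam i)"
  let ?D = "\<lambda>K. aff_dim (dual_cell (prodA K A) (prodlam K A lam) x)"
  have "?D (insert i K) = (\<Sum>j\<in>insert i K. aff_dim (dual_cell (A j) (lam j) x))"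
    using assms xi by (intro aff_dim_dual_cell_prod[where I = I]) (auto simp: stratum_def inter_J_def)
  also have "\<dots> = aff_dim (dual_cell (A i) (lam i) x) + (\<Sum>j\<in>K. aff_dim (dual_cell (A j) (lam j) x))"
    using assms(3,6) by simp
  also have "(\<Sum>j\<in>K. aff_dim (dual_cell (A j) (lam j) x)) = ?D K"
    using assms by (intro aff_dim_dual_cell_prod[where I = I, symmetric]) (auto simp: stratum_def)
  also have "?D K = int CARD('m)"
    using assms(5) by (simp add: stratum_def full_cells_def)
  finally have "?D (insert i K) \<ge> int CARD('m) + 1"
    using aff_dim_dual_cell_pos[OF assms(2) xi] assms(6) by simp
  moreover have "?D (insert i K) \<le> int CARD('m)"
    using aff_dim_le_DIM[of "dual_cell (prodA (insert i K) A) (prodlam (insert i K) A lam) x"] by simp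
  ultimately show False by linarith
qed

text \<open>Off its hypersurface a factor contributes a single point, so the two product cells are
  translates of each other.\<close>

lemma dual_cell_prod_restrict:
  assumes "finite J" "\<And>i. i \<in> J \<Longrightarrow> tpoly (A i)" "K \<subseteq> J"
    and "\<And>i. i \<in> J - K \<Longrightarrow> x \<notin> trop_hyp (A i) (lam i)"
  shows "aff_dim (dual_cell (prodA J A) (prodlam J A lam) x) =
           aff_dim (dual_cell (prodA K A) (prodlam K A lam) x)"
    and "measure lebesgue (dual_cell (prodA J A) (prodlam J A lam) x) =
           measure lebesgue (dual_cell (prodA K A) (prodlam K A lam) x)"
proof -
  have "\<exists>c. dual_cell (A i) (lam i) x = {c}" if "i \<in> J - K" for i
  proof -
    have "tpoly (A i)" using assms(2) that by blast
    then have "\<exists>a. argmax_set (A i) (lam i) x = {a}"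
      using assms(4)[OF that] trop_hyp_iff by blast
    then show ?thesis using dual_cell_singleton by blast
  qed
  then have "\<forall>i\<in>J - K. \<exists>c. dual_cell (A i) (lam i) x = {c}" by blast
  then obtain c where c: "\<forall>i\<in>J - K. dual_cell (A i) (lam i) x = {c i}"
    by (rule bchoice[THEN exE])
  have "dual_cell (prodA J A) (prodlam J A lam) x =
      (+) (\<Sum>i\<in>J - K. c i) ` dual_cell (prodA K A) (prodlam K A lam) x"
    using assms(1-3) c by (intro dual_cell_prod_translation) auto
  then show "aff_dim (dual_cell (prodA J A) (prodlam J A lam) x) =
           aff_dim (dual_cell (prodA K A) (prodlam K A lam) x)"
    and "measure lebesgue (dual_cell (prodA J A) (prodlam J A lam) x) =
           measure lebesgue (dual_cell (prodA K A) (prodlam K A lam) x)"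
    by (simp_all only: aff_dim_translation_eq measure_translation)
qed

lemma measure_newton_polytope_prodA:
  fixes A :: "nat \<Rightarrow> (int^'m) set"
  assumes "transversal I A lam" "\<And>i. i \<in> I \<Longrightarrow> tpoly (A i)" "finite J" "J \<subseteq> I"
  shows "measure lebesgue (newton_polytope (prodA J A)) =
    (\<Sum>K\<in>Pow J. \<Sum>x\<in>stratum K A lam. measure lebesgue (dual_cell (prodA K A) (prodlam K A lam) x))"
proof -
  let ?F = "full_cells (prodA J A) (prodlam J A lam)"
  let ?hyps = "\<lambda>x. {i \<in> J. x \<in> trop_hyp (A i) (lam i)}"
  have tp: "\<And>i. i \<in> J \<Longrightarrow> tpoly (A i)" using assms(2,4) by blast
  have tpJ: "tpoly (prodA J A)" by (rule tpoly_prodA[OF assms(3) tp])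
  have strata: "{x \<in> ?F. ?hyps x = K} = stratum K A lam" if K: "K \<subseteq> J" for K
  proof (intro set_eqI iffI)
    fix x assume x: "x \<in> {x \<in> ?F. ?hyps x = K}"
    then have "aff_dim (dual_cell (prodA J A) (prodlam J A lam) x) =
        aff_dim (dual_cell (prodA K A) (prodlam K A lam) x)"
      by (intro dual_cell_prod_restrict(1)[OF assms(3) tp K]) auto
    then show "x \<in> stratum K A lam"
      using x by (auto simp: stratum_def full_cells_def inter_J_def)
  next
    fix x assume x: "x \<in> stratum K A lam"
    \<comment> \<open>Transversality enters here: a point of the stratum lies on no hypersurface of
      \<open>J - K\<close>, so its type within \<open>J\<close> is exactly \<open>K\<close>.\<close>
    have no: "x \<notin> trop_hyp (A i) (lam i)" if "i \<in> J - K" for i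
      using that K assms finite_subset[OF K assms(3)] x
      by (intro stratum_not_in_other_hyp[where I = I and K = K]) auto
    then have "aff_dim (dual_cell (prodA J A) (prodlam J A lam) x) =
        aff_dim (dual_cell (prodA K A) (prodlam K A lam) x)"
      by (intro dual_cell_prod_restrict(1)[OF assms(3) tp K]) auto
    then show "x \<in> {x \<in> ?F. ?hyps x = K}"
      using x no K by (auto simp: stratum_def full_cells_def inter_J_def)
  qed
  have "measure lebesgue (newton_polytope (prodA J A)) =
      (\<Sum>x\<in>?F. measure lebesgue (dual_cell (prodA J A) (prodlam J A lam) x))"
    by (rule measure_newton_polytope[OF tpJ])
  also have "\<dots> = (\<Sum>K\<in>Pow J. \<Sum>x\<in>{x \<in> ?F. ?hyps x = K}.
      measure lebesgue (dual_cell (prodA J A) (prodlam J A lam) x))"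
    by (intro sum.group[symmetric] finite_full_cells tpJ) (use assms(3) in auto)
  also have "\<dots> = (\<Sum>K\<in>Pow J. \<Sum>x\<in>stratum K A lam.
      measure lebesgue (dual_cell (prodA K A) (prodlam K A lam) x))"
  proof (intro sum.cong refl)
    fix K x assume K: "K \<in> Pow J"
    then show "{x \<in> ?F. ?hyps x = K} = stratum K A lam" by (intro strata) auto
    assume "x \<in> stratum K A lam"
    then have "x \<in> {x \<in> ?F. ?hyps x = K}" using K strata by blast
    then show "measure lebesgue (dual_cell (prodA J A) (prodlam J A lam) x) =
        measure lebesgue (dual_cell (prodA K A) (prodlam K A lam) x)"
      using K by (intro dual_cell_prod_restrict(2)[OF assms(3) tp]) auto
  qed
  finally show ?thesis .
qed

section \<open>Vertices of the curve\<close>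

lemma argmax_set_direction:
  assumes "finite I" "\<And>i. i \<in> I \<Longrightarrow> tpoly (A i)"
    and sub: "dual_cell (prodA I A) (prodlam I A lam) x \<subseteq> {p. v \<bullet> p = b}"
    and i: "i \<in> I" "a \<in> argmax_set (A i) (lam i) x" "a' \<in> argmax_set (A i) (lam i) x"
  shows "v \<bullet> rvec a = v \<bullet> rvec a'"
proof -
  have "\<forall>j\<in>I. \<exists>c. c \<in> argmax_set (A j) (lam j) x"
    using argmax_set_nonempty[OF assms(2)] by (simp add: ex_in_conv)
  then obtain s where s: "\<forall>j\<in>I. s j \<in> argmax_set (A j) (lam j) x"
    by (rule bchoice[THEN exE])
  have "v \<bullet> rvec c + v \<bullet> (\<Sum>j\<in>I - {i}. rvec (s j)) = b"
    if c: "c \<in> argmax_set (A i) (lam i) x" for c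
  proof -
    \<comment> \<open>Only the summand at \<open>i\<close> is exchanged; the others stay fixed, so
      \<open>v\<close> takes the same value on all maximisers of factor \<open>i\<close>.\<close>
    let ?s = "s(i := c)"
    have "(\<Sum>j\<in>I. ?s j) \<in> argmax_set (prodA I A) (prodlam I A lam) x"
      using assms(1,2) s c by (simp add: argmax_set_prod sum_mem_prodA)
    then have "v \<bullet> rvec (\<Sum>j\<in>I. ?s j) = b"
      using rvec_mem_dual_cell sub by blast
    moreover have "(\<Sum>j\<in>I. ?s j) = c + (\<Sum>j\<in>I - {i}. s j)"
      using assms(1) i(1) by (simp add: sum.remove)
    moreover have "rvec (c + (\<Sum>j\<in>I - {i}. s j)) = rvec c + (\<Sum>j\<in>I - {i}. rvec (s j))"
      by (simp add: rvec_def vec_eq_iff)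
    ultimately show ?thesis by (simp add: inner_add_right)
  qed
  from this[OF i(2)] this[OF i(3)] show ?thesis by linarith
qed

text \<open>A full-dimensional product cell determines its point. Otherwise the product cell lies in
  a hyperplane with normal \<open>v\<close>, and a small move of \<open>x\<close> along
  \<open>v\<close> changes no set of maximisers, so the cell of \<open>x\<close> contains a second
  point.\<close>

lemma curve_vertices_eq_stratum:
  fixes A :: "nat \<Rightarrow> (int^'m) set"
  assumes "finite I" "\<And>i. i \<in> I \<Longrightarrow> tpoly (A i)"
  shows "curve_vertices I A lam = stratum I A lam"
proof -
  have tpI: "tpoly (prodA I A)" by (rule tpoly_prodA[OF assms])
  have "cell_J I A lam x = {x}" if "x \<in> full_cells (prodA I A) (prodlam I A lam)" for x
  proof -
    have "x = y" if y: "y \<in> cell_J I A lam x" for y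
    proof (rule dual_cell_full_dim_inject[OF tpI])
      show "aff_dim (dual_cell (prodA I A) (prodlam I A lam) x) = int CARD('m)"
        using \<open>x \<in> full_cells (prodA I A) (prodlam I A lam)\<close> by (simp add: full_cells_def)
      show "dual_cell (prodA I A) (prodlam I A lam) x = dual_cell (prodA I A) (prodlam I A lam) y"
        using y assms by (simp add: dual_cell_prod cell_J_def)
    qed
    moreover have "x \<in> cell_J I A lam x" by (simp add: cell_J_def)
    ultimately show ?thesis by blast
  qed
  moreover have "x \<in> full_cells (prodA I A) (prodlam I A lam)" if cell: "cell_J I A lam x = {x}" for x
  proof (rule ccontr)
    let ?D = "dual_cell (prodA I A) (prodlam I A lam) x"
    assume "x \<notin> full_cells (prodA I A) (prodlam I A lam)"
    then have "aff_dim ?D < int DIM(real^'m)"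
      using aff_dim_le_DIM[of ?D] by (simp add: full_cells_def)
    then obtain v b where v: "v \<noteq> 0" "?D \<subseteq> {p. v \<bullet> p = b}"
      using aff_lowdim_subset_hyperplane by metis
    have "\<forall>\<^sub>F t in at_right 0. \<forall>i\<in>I. argmax_set (A i) (lam i) (x + t *\<^sub>R v) \<subseteq> argmax_set (A i) (lam i) x"
      using assms by (intro eventually_ball_finite ballI eventually_argmax_set_subset_ray)
    then have "\<forall>\<^sub>F t::real in at_right 0. 0 < t \<and>
        (\<forall>i\<in>I. argmax_set (A i) (lam i) (x + t *\<^sub>R v) \<subseteq> argmax_set (A i) (lam i) x)"
      by (intro eventually_conj eventually_at_right_less)
    then obtain t :: real where t: "0 < t"
      "\<forall>i\<in>I. argmax_set (A i) (lam i) (x + t *\<^sub>R v) \<subseteq> argmax_set (A i) (lam i) x"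
      using eventually_happens'[OF trivial_limit_at_right_real] by blast
    have "argmax_set (A i) (lam i) (x + t *\<^sub>R v) = argmax_set (A i) (lam i) x" if i: "i \<in> I" for i
    proof (intro antisym t(2)[rule_format] i subsetI)
      fix a assume a: "a \<in> argmax_set (A i) (lam i) x"
      obtain c where c: "c \<in> argmax_set (A i) (lam i) (x + t *\<^sub>R v)"
        using argmax_set_nonempty[OF assms(2)[OF i]] by blast
      then have cx: "c \<in> argmax_set (A i) (lam i) x" using t(2) i by blast
      \<comment> \<open>The terms of \<open>a\<close> and \<open>c\<close> tie at \<open>x\<close>
        and change equally along \<open>v\<close>, so they still tie at the shifted point.\<close>
      have "v \<bullet> rvec a = v \<bullet> rvec c"
        by (rule argmax_set_direction[OF assms v(2) i a cx])
      then show "a \<in> argmax_set (A i) (lam i) (x + t *\<^sub>R v)"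
        using a c cx by (auto simp: argmax_set_def inner_add_right inner_commute[of v])
    qed
    then have "x + t *\<^sub>R v \<in> cell_J I A lam x"
      by (simp add: cell_J_def dual_cell_def)
    then show False using cell t(1) v(1) by simp
  qed
  ultimately show ?thesis by (auto simp: curve_vertices_def stratum_def)
qed

theorem theorem3p3:
  fixes n :: nat
    and A :: "nat \<Rightarrow> (int^'m) set"
    and lam :: "nat \<Rightarrow> int^'m \<Rightarrow> real"
    and d :: "nat \<Rightarrow> nat"
  assumes "n \<ge> 2"
    and "CARD('m) = n + 1"
    and "\<forall>i\<in>{1..n}. tpoly (A i)"
    and "\<forall>i\<in>{1..n}. smooth_hyp (A i) (lam i) (d i)"
    and "transversal {1..n} A lam"
  shows "finite (curve_vertices {1..n} A lam) \<and>
         (\<Sum>P\<in>curve_vertices {1..n} A lam. int_mult {1..n} A lam P) =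
           real ((\<Prod>i=1..n. d i) * (\<Sum>i=1..n. d i))"
proof
  let ?I = "{1..n}"
  define m where "m = CARD('m)"
  define w where "w K = (\<Sum>x\<in>stratum K A lam.
    measure lebesgue (dual_cell (prodA K A) (prodlam K A lam) x))" for K
  have tp: "\<And>i. i \<in> ?I \<Longrightarrow> tpoly (A i)" using assms(3) by blast
  have vert: "curve_vertices ?I A lam = stratum ?I A lam"
    by (rule curve_vertices_eq_stratum[OF finite_atLeastAtMost tp])
  have "tpoly (prodA ?I A)" by (rule tpoly_prodA[OF finite_atLeastAtMost tp])
  then show "finite (curve_vertices ?I A lam)"
    unfolding vert stratum_def by (intro finite_Int disjI2 finite_full_cells)
  \<comment> \<open>The Newton polytopes of the factors are standard simplices, whose Minkowski sum
    is the standard simplex of the total degree; its volume is computed a second time by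
    strata.\<close>
  have vol: "(\<Sum>K\<in>Pow J. w K) = (\<Sum>i\<in>J. real (d i)) ^ m / fact m" if J: "J \<in> Pow ?I" for J
  proof -
    have fin: "finite J" using J finite_subset by blast
    have "newton_polytope (prodA J A) = (\<Sum>i\<in>J. std_simplex (d i))"
      unfolding newton_polytope_prodA[OF fin]
      using J assms(4) by (intro sum.cong) (auto simp: smooth_hyp_def)
    then have "newton_polytope (prodA J A) = std_simplex (\<Sum>i\<in>J. d i)"
      by (simp add: sum_std_simplex)
    moreover have "measure lebesgue (newton_polytope (prodA J A)) = (\<Sum>K\<in>Pow J. w K)"
      unfolding w_def using J by (intro measure_newton_polytope_prodA[OF assms(5) tp fin]) auto
    ultimately show ?thesis by (simp add: measure_std_simplex m_def)
  qed
  have "w ?I = (\<Sum>J\<in>Pow ?I. (-1) ^ card (?I - J) * (\<Sum>K\<in>Pow J. w K))"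
    by (rule subset_moebius_inversion[symmetric]) simp
  also have "\<dots> = (\<Sum>J\<in>Pow ?I. (-1) ^ card (?I - J) * ((\<Sum>i\<in>J. real (d i)) ^ m / fact m))"
    using vol by (intro sum.cong) auto
  also have "\<dots> = alt_power_sum (\<lambda>i. real (d i)) ?I m / fact m"
    by (simp add: alt_power_sum_def sum_divide_distrib)
  \<comment> \<open>Here \<open>m\<close> is one more than the number of hypersurfaces, so the
    second nonvanishing value applies; its factor 1/2 cancels against the 2 in
    \<open>int_mult\<close>.\<close>
  also have "alt_power_sum (\<lambda>i. real (d i)) ?I m =
      fact m / 2 * (\<Prod>i\<in>?I. real (d i)) * (\<Sum>i\<in>?I. real (d i))"
    using alt_power_sum_values[of ?I "\<lambda>i. real (d i)"] assms(2) by (simp add: m_def)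
  finally have "2 * w ?I = (\<Prod>i\<in>?I. real (d i)) * (\<Sum>i\<in>?I. real (d i))"
    by simp
  then show "(\<Sum>P\<in>curve_vertices ?I A lam. int_mult ?I A lam P) =
      real ((\<Prod>i=1..n. d i) * (\<Sum>i=1..n. d i))"
    unfolding vert by (simp add: w_def int_mult_def sum_distrib_left[symmetric])
qed

end
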